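(* Let $\varphi:\mathbb R\to\mathbb R$ and $q:\mathbb R\to\mathbb R$ be continuous functions with $\varphi(x)\ge 0$ and $q(x)\ge 1$ for all $x\in\mathbb R$. Suppose there is a constant $a\ge 1$ such that $a^{-1}q(x)\le q(t)\le a\,q(x)$ for all $x\in\mathbb R$ and all $t\in[x-1,x+1]$, and that $\sup_{x\in\mathbb R}(\varphi(x)q(x))\le \frac{1}{6\sqrt a}$. Then there is a constant $c\in(0,\infty)$ such that for every $f\in C(\mathbb R)$ the solution $y\in C(\mathbb R)$ of the equation $$-y''(x)+q(x)\,y(x-\varphi(x))=f(x),\qquad x\in\mathbb R,$$ satisfies the estimate $$\|q(x)y(x)\|_{C(\mathbb R)}\le c\|f(x)\|_{C(\mathbb R)}.$$
   Context: $C(\mathbb R)$ is the space of bounded continuous functions on $\mathbb R$ with the norm $\|f\|_{C(\mathbb R)}=\sup_{x\in\mathbb R}|f(x)|$. A solution of the equation is any twice continuously differentiable function $y$ on $\mathbb R$ satisfying it for all $x\in\mathbb R$. Under the stated hypotheses, for every $f\in C(\mathbb R)$ the equation has a unique solution belonging to $C(\mathbb R)$; this is "the solution $y\in C(\mathbb R)$". *)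

theory Defs
  imports "HOL-Analysis.Analysis"
begin

text \<open>The space of bounded continuous real functions on the line is the library type
  \<^typ>\<open>real \<Rightarrow>\<^sub>C real\<close>, whose norm is the supremum norm.\<close>

definition delay_solution ::
  "(real \<Rightarrow> real) \<Rightarrow> (real \<Rightarrow> real) \<Rightarrow> (real \<Rightarrow> real) \<Rightarrow> (real \<Rightarrow> real) \<Rightarrow> bool" where
  "delay_solution \<phi> q f y \<longleftrightarrow>
     (\<exists>y' y''. (\<forall>x. (y has_real_derivative y' x) (at x)) \<and>
               (\<forall>x. (y' has_real_derivative y'' x) (at x)) \<and>
               continuous_on UNIV y'' \<and>
               (\<forall>x. - y'' x + q x * y (x - \<phi> x) = f x))"

end

theory Submission imports Defs begin

text \<open>
  Put \<open>F = \<parallel>f\<parallel>\<close> and move the delay to the right-hand side: \<open>- y'' + q y = g\<close> with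
  \<open>g x = f x + q x * (y x - y (x - \<phi> x))\<close>. By the mean value theorem the new term is
  \<open>q x * \<phi> x * y' \<xi>\<close>, and \<open>\<phi> q \<le> 1/6\<close>. Hence, if \<open>P = sup \<bar>y'\<bar>\<close> is finite, the delay is a
  perturbation of size \<open>P/6\<close> of the equation without delay.

  For \<open>- y'' + q y = g\<close> with \<open>\<bar>g\<bar> \<le> G\<close> and \<open>q \<ge> 1\<close>, a bounded solution satisfies
  \<open>\<bar>y\<bar> \<le> G\<close> (maximum principle) and \<open>\<bar>y'\<bar> \<le> 2 G\<close> (a larger slope
  at a point where \<open>y \<ge> 0\<close> would make \<open>y\<close> exceed \<open>G\<close> within unit distance). With \<open>G = F + P/6\<close> this gives \<open>P \<le> 2 F + P/3\<close>,
  so \<open>P \<le> 3 F\<close> and \<open>G \<le> 3/2 F\<close>. On the unit neighbourhood of a point \<open>x\<close> the coefficient is at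
  least \<open>q x / a\<close>, and comparison there with a parabola turns \<open>\<bar>y\<bar> \<le> G\<close> into
  \<open>\<bar>y x\<bar> \<le> 3 a G / q x\<close>, which is the assertion.

  This absorption needs \<open>P < \<infinity>\<close>, which is not immediate: where \<open>q\<close> is large, the equation
  permits large \<open>y''\<close> even though \<open>y\<close> and \<open>f\<close> are bounded. Finiteness is
  obtained by improving bounds by powers of \<open>s = sqrt q\<close>, with constants that may depend on \<open>y\<close>. As \<open>y\<close> is bounded, \<open>y''\<close> is \<open>O(s\<^sup>2)\<close>, and interpolation at the length scale \<open>1/s\<close> gives
  \<open>y' = O(s)\<close>. Therefore \<open>g = O(s)\<close>, and the parabola comparison improves the bound on \<open>y\<close> to
  \<open>O(1/s)\<close>. Now \<open>y'' = O(s)\<close>, and a second interpolation gives \<open>y' = O(1)\<close>.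
\<close>

section \<open>Comparison principles for the equation without delay\<close>

lemma maximum_principle:
  fixes z z' z'' :: "real \<Rightarrow> real"
  assumes "l < r"
    and z: "\<And>x. (z has_real_derivative z' x) (at x)"
    and z': "\<And>x. (z' has_real_derivative z'' x) (at x)"
    and ends: "z l \<le> 0" "z r \<le> 0"
    and conv: "\<And>x. l < x \<Longrightarrow> x < r \<Longrightarrow> z x > 0 \<Longrightarrow> z'' x > 0"
    and "x \<in> {l..r}"
  shows "z x \<le> 0"
proof (rule ccontr)
  assume "\<not> z x \<le> 0"
  have "continuous_on {l..r} z"
    using z by (meson DERIV_isCont continuous_at_imp_continuous_on)
  then obtain m where m: "m \<in> {l..r}" "\<And>u. u \<in> {l..r} \<Longrightarrow> z u \<le> z m"
    using continuous_attains_sup[of "{l..r}" z] \<open>l < r\<close> by auto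
  have "z m > 0"
    using m(2)[OF \<open>x \<in> {l..r}\<close>] \<open>\<not> z x \<le> 0\<close> by linarith
  then have lm: "l < m" "m < r"
    using m(1) ends by (auto simp: less_le)
  define d where "d = min (m - l) (r - m)"
  have "d > 0" using lm by (simp add: d_def)
  have "z' m = 0"
    by (rule DERIV_local_max[OF z \<open>d > 0\<close>]) (auto intro!: m(2) simp: d_def)
  \<comment> \<open>A critical point with positive second derivative is a strict local minimum, which a maximum
    cannot be.\<close>
  obtain e where e: "e > 0" "\<And>h. 0 < h \<Longrightarrow> h < e \<Longrightarrow> z' m < z' (m + h)"
    using DERIV_pos_inc_right[OF z' conv[OF lm \<open>z m > 0\<close>]] by blast
  define h where "h = min d e / 2"
  have h: "0 < h" "h < d" "h < e" using \<open>d > 0\<close> e(1) by (auto simp: h_def)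
  have "z m < z (m + h)"
  proof (rule DERIV_pos_imp_increasing_open[where f = z])
    show "m < m + h" using h by simp
    show "\<exists>v. DERIV z u :> v \<and> v > 0" if "m < u" "u < m + h" for u
      using z[of u] e(2)[of "u - m"] that h \<open>z' m = 0\<close> by auto
    show "continuous_on {m..m + h} z"
      using z by (meson DERIV_isCont continuous_at_imp_continuous_on)
  qed
  moreover have "z (m + h) \<le> z m"
    using h by (intro m(2)) (auto simp: d_def)
  ultimately show False by simp
qed

text \<open>The comparison function is \<open>K / \<mu> + 2 B / (R\<^sup>2 \<mu>) + B (t - x)\<^sup>2 / R\<^sup>2\<close>: its last term dominates
  \<open>y\<close> at the ends of the interval, and its second term compensates the second derivative of the
  last one. For large \<open>R\<close> the bound tends to \<open>K / \<mu>\<close>; for \<open>R = 1\<close> it shows that \<open>y\<close> is small where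
  \<open>q\<close> is large.\<close>

lemma upper_bound_by_parabola:
  fixes y y' y'' q g :: "real \<Rightarrow> real"
  assumes y: "\<And>x. (y has_real_derivative y' x) (at x)"
    and y': "\<And>x. (y' has_real_derivative y'' x) (at x)"
    and eq: "\<And>x. - y'' x + q x * y x = g x"
    and "R > 0" "\<mu> > 0" "K \<ge> 0" "B \<ge> 0"
    and yB: "\<And>t. \<bar>t - x\<bar> \<le> R \<Longrightarrow> y t \<le> B"
    and qm: "\<And>t. \<bar>t - x\<bar> \<le> R \<Longrightarrow> \<mu> \<le> q t"
    and gK: "\<And>t. \<bar>t - x\<bar> \<le> R \<Longrightarrow> g t \<le> K"
  shows "y x \<le> (K + 2 * B / R\<^sup>2) / \<mu>"
proof -
  define D where "D = B / R\<^sup>2"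
  have "D \<ge> 0" using assms by (simp add: D_def)
  define c where "c = (K + 2 * D) / \<mu>"
  have "c \<ge> 0" using assms \<open>D \<ge> 0\<close> by (simp add: c_def)
  have cm: "\<mu> * c = K + 2 * D" using \<open>\<mu> > 0\<close> by (simp add: c_def)
  have DR: "D * R\<^sup>2 = B" using \<open>R > 0\<close> by (simp add: D_def)
  have "y x - (c + D * (x - x)\<^sup>2) \<le> 0"
  proof (rule maximum_principle[where l = "x - R" and r = "x + R" and
        z = "\<lambda>t. y t - (c + D * (t - x)\<^sup>2)" and z' = "\<lambda>t. y' t - D * (2 * (t - x))" and
        z'' = "\<lambda>t. y'' t - 2 * D"])
    show "((\<lambda>t. y t - (c + D * (t - x)\<^sup>2)) has_real_derivative y' t - D * (2 * (t - x))) (at t)" for t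
      by (auto intro!: derivative_eq_intros y)
    show "((\<lambda>t. y' t - D * (2 * (t - x))) has_real_derivative y'' t - 2 * D) (at t)" for t
      by (auto intro!: derivative_eq_intros y')
    show "y (x - R) - (c + D * (x - R - x)\<^sup>2) \<le> 0"
      using yB[of "x - R"] \<open>R > 0\<close> \<open>c \<ge> 0\<close> DR by simp
    show "y (x + R) - (c + D * (x + R - x)\<^sup>2) \<le> 0"
      using yB[of "x + R"] \<open>R > 0\<close> \<open>c \<ge> 0\<close> DR by simp
    show "0 < y'' t - 2 * D"
      if "x - R < t" "t < x + R" and pos: "0 < y t - (c + D * (t - x)\<^sup>2)" for t
    proof -
      have t: "\<bar>t - x\<bar> \<le> R" using that by linarith
      have "D * (t - x)\<^sup>2 \<ge> 0" using \<open>D \<ge> 0\<close> by simp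
      then have "y t > c" using pos by linarith
      then have "\<mu> * c < \<mu> * y t" using \<open>\<mu> > 0\<close> by simp
      also have "\<dots> \<le> q t * y t"
        using qm[OF t] \<open>y t > c\<close> \<open>c \<ge> 0\<close> by (intro mult_right_mono) auto
      finally show ?thesis using eq[of t] gK[OF t] cm by linarith
    qed
  qed (use \<open>R > 0\<close> in auto)
  then show ?thesis by (simp add: c_def D_def)
qed

lemma abs_bound_by_parabola:
  fixes y y' y'' q g :: "real \<Rightarrow> real"
  assumes y: "\<And>x. (y has_real_derivative y' x) (at x)"
    and y': "\<And>x. (y' has_real_derivative y'' x) (at x)"
    and eq: "\<And>x. - y'' x + q x * y x = g x"
    and pos: "R > 0" "\<mu> > 0" "K \<ge> 0" "B \<ge> 0"
    and yB: "\<And>t. \<bar>t - x\<bar> \<le> R \<Longrightarrow> \<bar>y t\<bar> \<le> B"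
    and qm: "\<And>t. \<bar>t - x\<bar> \<le> R \<Longrightarrow> \<mu> \<le> q t"
    and gK: "\<And>t. \<bar>t - x\<bar> \<le> R \<Longrightarrow> \<bar>g t\<bar> \<le> K"
  shows "\<bar>y x\<bar> \<le> (K + 2 * B / R\<^sup>2) / \<mu>"
proof -
  have "y x \<le> (K + 2 * B / R\<^sup>2) / \<mu>"
    using yB gK by (intro upper_bound_by_parabola[OF y y' eq pos _ qm]) (auto simp: abs_le_iff)
  moreover have "- y x \<le> (K + 2 * B / R\<^sup>2) / \<mu>"
  proof (rule upper_bound_by_parabola[where y = "\<lambda>t. - y t" and y' = "\<lambda>t. - y' t" and
        y'' = "\<lambda>t. - y'' t" and q = q and g = "\<lambda>t. - g t"])
    show "- (- y'' t) + q t * - y t = - g t" for t using eq[of t] by simp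
  qed (use yB gK qm pos in \<open>auto simp: abs_le_iff intro!: DERIV_minus y y'\<close>)
  ultimately show ?thesis by (simp add: abs_le_iff)
qed

lemma bounded_solution_bound:
  fixes y y' y'' q g :: "real \<Rightarrow> real"
  assumes y: "\<And>x. (y has_real_derivative y' x) (at x)"
    and y': "\<And>x. (y' has_real_derivative y'' x) (at x)"
    and eq: "\<And>x. - y'' x + q x * y x = g x"
    and yB: "\<And>x. \<bar>y x\<bar> \<le> B"
    and q1: "\<And>x. 1 \<le> q x"
    and gG: "\<And>x. \<bar>g x\<bar> \<le> G"
  shows "\<bar>y x\<bar> \<le> G"
proof -
  have "B \<ge> 0" "G \<ge> 0" using yB[of 0] gG[of 0] by linarith+
  then have *: "\<bar>y x\<bar> \<le> G + 2 * B / (real n)\<^sup>2" if "n > 0" for n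
    using abs_bound_by_parabola[OF y y' eq, of "real n" 1 G B x] that yB q1 gG by simp
  have "(\<lambda>n. G + 2 * B / (real n)\<^sup>2) \<longlonglongrightarrow> G + 0"
    by real_asymp
  then show ?thesis
    using * by (intro LIMSEQ_le_const[of _ G]) (auto intro!: exI[of _ 1])
qed

text \<open>Where \<open>y \<ge> 0\<close>, the equation bounds \<open>y''\<close> from below by \<open>- G\<close>, however large \<open>q\<close> is. So if
  \<open>y\<close> starts to grow with slope above \<open>2 G\<close>, then its slope stays above \<open>G\<close> over a unit length and
  \<open>y\<close> exceeds \<open>G\<close>.\<close>

lemma slope_bound_at_nonneg:
  fixes y y' y'' q g :: "real \<Rightarrow> real"
  assumes y: "\<And>x. (y has_real_derivative y' x) (at x)"
    and y': "\<And>x. (y' has_real_derivative y'' x) (at x)"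
    and eq: "\<And>x. - y'' x + q x * y x = g x"
    and q0: "\<And>x. 0 \<le> q x"
    and gG: "\<And>x. \<bar>g x\<bar> \<le> G"
    and yG: "\<And>x. y x \<le> G"
    and "y x \<ge> 0"
  shows "y' x \<le> 2 * G"
proof (rule ccontr)
  assume "\<not> y' x \<le> 2 * G"
  then have p: "y' x > 2 * G" by simp
  have "G \<ge> 0" using gG[of 0] by linarith
  have slope: "y' t \<ge> y' x - G * (t - x)"
    if "x \<le> t" and inc: "\<And>u. x \<le> u \<Longrightarrow> u < t \<Longrightarrow> y' u > 0" for t
  proof -
    have "y x \<le> y u" if "x \<le> u" "u \<le> t" for u
    proof -
      have "y x < y u" if "x < u"
      proof (rule DERIV_pos_imp_increasing_open[where f = y, OF that])
        show "\<exists>v. DERIV y w :> v \<and> v > 0" if "x < w" "w < u" for w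
          using y[of w] inc[of w] that \<open>u \<le> t\<close> by auto
        show "continuous_on {x..u} y"
          using y by (meson DERIV_isCont continuous_at_imp_continuous_on)
      qed
      then show ?thesis using \<open>x \<le> u\<close> by (cases "x = u") auto
    qed
    then have "y u \<ge> 0" if "x \<le> u" "u \<le> t" for u using that \<open>y x \<ge> 0\<close> by force
    then have "y'' u \<ge> - G" if "x \<le> u" "u \<le> t" for u
      using that eq[of u] gG[of u] mult_nonneg_nonneg[OF q0[of u], of "y u"] by (auto simp: abs_le_iff)
    then have "y' x + G * x \<le> y' t + G * t"
      using \<open>x \<le> t\<close>
      by (intro DERIV_nonneg_imp_nondecreasing[where f = "\<lambda>t. y' t + G * t"])
        (auto intro!: derivative_eq_intros y' exI[of _ "y'' _ + G"], force)
    then show ?thesis by (simp add: algebra_simps)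
  qed
  have inc: "y' t > 0" if t: "t \<in> {x..x + 1}" for t
  proof (rule ccontr)
    \<comment> \<open>Stop at the first point at which the slope is no longer positive: up to there the lower
      bound for the slope applies.\<close>
    assume "\<not> y' t > 0"
    define S where "S = {u \<in> {x..x + 1}. y' u \<le> 0}"
    have "continuous_on {x..x + 1} y'"
      using y' by (meson DERIV_isCont continuous_at_imp_continuous_on)
    then have "closed S"
      unfolding S_def by (intro continuous_on_closed_Collect_le) auto
    moreover have "bounded S"
      by (rule bounded_subset[of "{x..x + 1}"]) (auto simp: S_def)
    ultimately have "compact S" by (simp add: compact_eq_bounded_closed)
    then obtain m where m: "m \<in> S" "\<And>u. u \<in> S \<Longrightarrow> m \<le> u"
      using compact_attains_inf[of S] t \<open>\<not> y' t > 0\<close> by (force simp: S_def)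
    have "y' u > 0" if "x \<le> u" "u < m" for u
      using m that by (force simp: S_def)
    then have "y' m \<ge> y' x - G * (m - x)"
      using slope[of m] m(1) by (auto simp: S_def)
    moreover have "G * (m - x) \<le> G * 1"
      using m(1) \<open>G \<ge> 0\<close> by (intro mult_left_mono) (auto simp: S_def)
    ultimately show False using m(1) p \<open>G \<ge> 0\<close> by (simp add: S_def)
  qed
  have "y x + G * (x + 1 - x) < y (x + 1)"
  proof -
    obtain u where u: "x < u" "u < x + 1" "y (x + 1) - y x = (x + 1 - x) * y' u"
      using MVT2[of x "x + 1" y y'] y by auto
    have "y' u \<ge> y' x - G * (u - x)"
      using slope[of u] inc u by auto
    moreover have "G * (u - x) \<le> G * 1"
      using u \<open>G \<ge> 0\<close> by (intro mult_left_mono) auto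
    ultimately show ?thesis using u(3) p by simp
  qed
  then show False using yG[of "x + 1"] \<open>y x \<ge> 0\<close> by simp
qed

text \<open>The substitutions \<open>y \<mapsto> - y\<close> and \<open>x \<mapsto> - x\<close> preserve the form of the equation and
  the bounds; they reduce the four
  combinations of the signs of \<open>y x\<close> and \<open>y' x\<close> to one.\<close>

lemma bounded_solution_slope_bound:
  fixes y y' y'' q g :: "real \<Rightarrow> real"
  assumes y: "\<And>x. (y has_real_derivative y' x) (at x)"
    and y': "\<And>x. (y' has_real_derivative y'' x) (at x)"
    and eq: "\<And>x. - y'' x + q x * y x = g x"
    and q0: "\<And>x. 0 \<le> q x"
    and gG: "\<And>x. \<bar>g x\<bar> \<le> G"
    and yG: "\<And>x. \<bar>y x\<bar> \<le> G"
  shows "\<bar>y' x\<bar> \<le> 2 * G"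
proof -
  have nonneg: "\<bar>v' x\<bar> \<le> 2 * G"
    if v: "\<And>x. (v has_real_derivative v' x) (at x)"
      and v': "\<And>x. (v' has_real_derivative v'' x) (at x)"
      and veq: "\<And>x. - v'' x + q x * v x = k x"
      and kG: "\<And>x. \<bar>k x\<bar> \<le> G"
      and vG: "\<And>x. v x \<le> G"
      and "v x \<ge> 0" for v v' v'' k
  proof -
    have "v' x \<le> 2 * G"
      by (rule slope_bound_at_nonneg[OF v v' veq q0 kG vG \<open>v x \<ge> 0\<close>])
    moreover have "- v' (- (- x)) \<le> 2 * G"
    proof (rule slope_bound_at_nonneg[where y = "\<lambda>t. v (- t)" and y' = "\<lambda>t. - v' (- t)" and
          y'' = "\<lambda>t. v'' (- t)" and q = "\<lambda>t. q (- t)" and g = "\<lambda>t. k (- t)"])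
      show "((\<lambda>t. v (- t)) has_real_derivative - v' (- t)) (at t)" for t
        using DERIV_chain2[OF v DERIV_minus[OF DERIV_ident], of t] by simp
      show "((\<lambda>t. - v' (- t)) has_real_derivative v'' (- t)) (at t)" for t
        using DERIV_minus[OF DERIV_chain2[OF v' DERIV_minus[OF DERIV_ident], of t]] by simp
    qed (use veq q0 kG vG \<open>v x \<ge> 0\<close> in auto)
    ultimately show ?thesis by (simp add: abs_le_iff)
  qed
  show ?thesis
  proof (cases "y x \<ge> 0")
    case True
    then show ?thesis
      using yG by (intro nonneg[OF y y' eq gG]) (auto simp: abs_le_iff)
  next
    case False
    have "\<bar>- y' x\<bar> \<le> 2 * G"
    proof (rule nonneg[where v = "\<lambda>t. - y t" and v' = "\<lambda>t. - y' t" and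
          v'' = "\<lambda>t. - y'' t" and k = "\<lambda>t. - g t"])
      show "- (- y'' t) + q t * - y t = - g t" for t using eq[of t] by simp
    qed (use yG gG False in \<open>auto simp: abs_le_iff intro!: DERIV_minus y y'\<close>)
    then show ?thesis by simp
  qed
qed

section \<open>Boundedness of the derivative of a bounded solution\<close>

text \<open>Somewhere in the interval the slope equals the mean slope, which is at most \<open>2 B / h\<close>; from
  there to \<open>x\<close> it changes by at most \<open>h D\<close>. The choice \<open>h = 1/s\<close> balances the two terms when \<open>D\<close>
  is of the order of \<open>s\<^sup>2 B\<close>.\<close>

lemma derivative_interpolation:
  fixes y y' y'' :: "real \<Rightarrow> real"
  assumes y: "\<And>x. (y has_real_derivative y' x) (at x)"
    and y': "\<And>x. (y' has_real_derivative y'' x) (at x)"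
    and "h > 0"
    and yB: "\<And>t. t \<in> {x..x + h} \<Longrightarrow> \<bar>y t\<bar> \<le> B"
    and yD: "\<And>t. t \<in> {x..x + h} \<Longrightarrow> \<bar>y'' t\<bar> \<le> D"
  shows "\<bar>y' x\<bar> \<le> 2 * B / h + h * D"
proof -
  obtain u where u: "x < u" "u < x + h" "y (x + h) - y x = (x + h - x) * y' u"
    using MVT2[of x "x + h" y y'] y \<open>h > 0\<close> by auto
  obtain v where v: "x < v" "v < u" "y' u - y' x = (u - x) * y'' v"
    using MVT2[of x u y' y''] y' u by auto
  have "h * \<bar>y' u\<bar> = \<bar>y (x + h) - y x\<bar>"
    using u(3) \<open>h > 0\<close> by (simp add: abs_mult)
  also have "\<dots> \<le> 2 * B"
    using yB[of x] yB[of "x + h"] \<open>h > 0\<close> by auto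
  finally have "\<bar>y' u\<bar> \<le> 2 * B / h"
    using \<open>h > 0\<close> by (simp add: field_simps)
  moreover have "\<bar>(u - x) * y'' v\<bar> \<le> h * D"
    unfolding abs_mult using u v yD[of v] by (intro mult_mono) auto
  ultimately show ?thesis using v(3) by linarith
qed

lemma delay_term_bound:
  fixes y y' :: "real \<Rightarrow> real"
  assumes y: "\<And>x. (y has_real_derivative y' x) (at x)"
    and "d \<ge> 0" "k \<ge> 0"
    and yN: "\<And>t. t \<in> {x - d..x} \<Longrightarrow> \<bar>y' t\<bar> \<le> N"
  shows "\<bar>k * (y x - y (x - d))\<bar> \<le> d * k * N"
proof (cases "d = 0")
  case False
  then obtain u where u: "x - d < u" "u < x" "y x - y (x - d) = (x - (x - d)) * y' u"
    using MVT2[of "x - d" x y y'] y \<open>d \<ge> 0\<close> by auto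
  have "\<bar>k * (y x - y (x - d))\<bar> = (d * k) * \<bar>y' u\<bar>"
    using u(3) \<open>d \<ge> 0\<close> \<open>k \<ge> 0\<close> by (simp add: abs_mult)
  also have "\<dots> \<le> (d * k) * N"
    using yN[of u] u \<open>d \<ge> 0\<close> \<open>k \<ge> 0\<close> by (intro mult_left_mono) auto
  finally show ?thesis .
qed simp

text \<open>The coefficient is written as \<open>q = s\<^sup>2\<close>, so that the successive bounds \<open>y' = O(s)\<close>, \<open>y = O(1/s)\<close>
  and \<open>y' = O(1)\<close> involve only integral powers of \<open>s\<close>. Slow variation of \<open>s\<close> permits freezing \<open>s\<close>
  on unit neighbourhoods, which contain the interpolation interval of length \<open>1/s\<close> and the delayed
  argument.\<close>

lemma delay_solution_derivative_bounded:
  fixes y y' y'' s f \<phi> :: "real \<Rightarrow> real"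
  assumes y: "\<And>x. (y has_real_derivative y' x) (at x)"
    and y': "\<And>x. (y' has_real_derivative y'' x) (at x)"
    and eq: "\<And>x. - y'' x + (s x)\<^sup>2 * y (x - \<phi> x) = f x"
    and yB: "\<And>x. \<bar>y x\<bar> \<le> B"
    and fF: "\<And>x. \<bar>f x\<bar> \<le> F"
    and s1: "\<And>x. s x \<ge> 1"
    and s_slow: "\<And>x t. \<bar>t - x\<bar> \<le> 1 \<Longrightarrow> s t \<le> b * s x"
    and \<phi>0: "\<And>x. \<phi> x \<ge> 0"
    and \<phi>s: "\<And>x. \<phi> x * (s x)\<^sup>2 \<le> 1"
  shows "\<exists>P. \<forall>x. \<bar>y' x\<bar> \<le> P"
proof -
  have B0: "B \<ge> 0" and F0: "F \<ge> 0" using yB[of 0] fF[of 0] by linarith+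
  have s0: "s x > 0" for x using s1[of x] by linarith
  have b1: "b \<ge> 1" using s_slow[of 0 0] s0[of 0] by simp
  have s_sq: "(s x)\<^sup>2 \<ge> 1" for x using s1[of x] by (simp add: one_le_power)
  have \<phi>1: "\<phi> x \<le> 1" for x
    using mult_left_mono[OF s_sq[of x] \<phi>0[of x]] \<phi>s[of x] by simp
  have h1: "1 / s x \<le> 1" for x using s1[of x] by (simp add: field_simps)
  have near: "\<bar>t - x\<bar> \<le> 1" if "t \<in> {x..x + 1 / s x}" for t x
    using that h1[of x] by auto
  have near_delay: "\<bar>t - x\<bar> \<le> 1" if "t \<in> {x - \<phi> x..x}" for t x
    using that \<phi>1[of x] by auto

  define C1 where "C1 = 2 * B + (F + b\<^sup>2 * B)"
  have "C1 \<ge> 0" using B0 F0 by (simp add: C1_def)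
  have y'1: "\<bar>y' x\<bar> \<le> C1 * s x" for x
  proof -
    have "\<bar>y' x\<bar> \<le> 2 * B / (1 / s x) + 1 / s x * ((F + b\<^sup>2 * B) * (s x)\<^sup>2)"
    proof (rule derivative_interpolation[OF y y'])
      fix t assume t: "t \<in> {x..x + 1 / s x}"
      have "(s t)\<^sup>2 \<le> (b * s x)\<^sup>2"
        using s_slow[OF near[OF t]] s0[of t] by (intro power_mono) auto
      then have "(s t)\<^sup>2 * \<bar>y (t - \<phi> t)\<bar> \<le> (b * s x)\<^sup>2 * B"
        using yB by (intro mult_mono) auto
      moreover have "\<bar>y'' t\<bar> \<le> F + (s t)\<^sup>2 * \<bar>y (t - \<phi> t)\<bar>"
        using eq[of t] fF[of t] abs_mult[of "(s t)\<^sup>2" "y (t - \<phi> t)"] by simp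
      moreover have "F * 1 \<le> F * (s x)\<^sup>2" by (intro mult_left_mono s_sq F0)
      ultimately show "\<bar>y'' t\<bar> \<le> (F + b\<^sup>2 * B) * (s x)\<^sup>2"
        by (simp add: algebra_simps power_mult_distrib)
    qed (use s0 yB in auto)
    also have "\<dots> = C1 * s x"
      using s0[of x] by (simp add: C1_def power2_eq_square field_simps)
    finally show ?thesis .
  qed

  define g where "g x = f x + (s x)\<^sup>2 * (y x - y (x - \<phi> x))" for x
  have eq': "- y'' x + (s x)\<^sup>2 * y x = g x" for x
    using eq[of x] by (simp add: g_def algebra_simps)
  define C2 where "C2 = F + C1 * b"
  have "C2 \<ge> 0" using F0 \<open>C1 \<ge> 0\<close> b1 by (simp add: C2_def)
  have g2: "\<bar>g x\<bar> \<le> C2 * s x" for x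
  proof -
    have "\<bar>(s x)\<^sup>2 * (y x - y (x - \<phi> x))\<bar> \<le> \<phi> x * (s x)\<^sup>2 * (C1 * (b * s x))"
    proof (rule delay_term_bound[OF y \<phi>0])
      fix t assume "t \<in> {x - \<phi> x..x}"
      then have "C1 * s t \<le> C1 * (b * s x)"
        by (intro mult_left_mono s_slow near_delay \<open>C1 \<ge> 0\<close>)
      then show "\<bar>y' t\<bar> \<le> C1 * (b * s x)" using y'1[of t] by linarith
    qed simp
    also have "\<dots> \<le> 1 * (C1 * (b * s x))"
      using \<open>C1 \<ge> 0\<close> b1 s0[of x] by (intro mult_right_mono \<phi>s) auto
    finally have "\<bar>g x\<bar> \<le> F + C1 * (b * s x)"
      using fF[of x] by (simp add: g_def)
    moreover have "F * 1 \<le> F * s x" by (intro mult_left_mono s1 F0)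
    ultimately show ?thesis by (simp add: C2_def algebra_simps)
  qed

  define C3 where "C3 = (C2 * b + 2 * B) * b\<^sup>2"
  have "C3 \<ge> 0" using \<open>C2 \<ge> 0\<close> B0 b1 by (simp add: C3_def)
  have y3: "\<bar>y x\<bar> \<le> C3 / s x" for x
  proof -
    have "\<bar>y x\<bar> \<le> (C2 * (b * s x) + 2 * B / 1\<^sup>2) / (s x / b)\<^sup>2"
    proof (rule abs_bound_by_parabola[OF y y' eq'])
      fix t assume t: "\<bar>t - x\<bar> \<le> (1::real)"
      have "s x \<le> b * s t" using t by (intro s_slow) (simp add: abs_minus_commute)
      then have "s x / b \<le> s t" using b1 by (simp add: field_simps)
      then show "(s x / b)\<^sup>2 \<le> (s t)\<^sup>2"
        using b1 s0[of x] by (intro power_mono) auto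
      have "C2 * s t \<le> C2 * (b * s x)"
        by (intro mult_left_mono s_slow t \<open>C2 \<ge> 0\<close>)
      then show "\<bar>g t\<bar> \<le> C2 * (b * s x)" using g2[of t] by linarith
    qed (use s0[of x] b1 yB B0 \<open>C2 \<ge> 0\<close> in auto)
    also have "\<dots> = (C2 * b * s x + 2 * B) * b\<^sup>2 / (s x)\<^sup>2"
      by (simp add: power_divide algebra_simps)
    also have "\<dots> \<le> ((C2 * b + 2 * B) * s x) * b\<^sup>2 / (s x)\<^sup>2"
      using mult_left_mono[OF s1[of x], of "2 * B"] B0
      by (intro divide_right_mono mult_right_mono) (auto simp: algebra_simps)
    also have "\<dots> = C3 / s x"
      using s0[of x] by (simp add: C3_def power2_eq_square field_simps)
    finally show ?thesis .
  qed
  have y3': "\<bar>y t\<bar> \<le> C3 * b / s x" if "\<bar>t - x\<bar> \<le> 1" for t x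
  proof -
    have "s x \<le> b * s t" using that by (intro s_slow) (simp add: abs_minus_commute)
    then have "1 / s t \<le> b / s x" using s0[of x] s0[of t] by (simp add: field_simps)
    then have "C3 * (1 / s t) \<le> C3 * (b / s x)" by (intro mult_left_mono \<open>C3 \<ge> 0\<close>)
    then show ?thesis using y3[of t] by simp
  qed

  define C4 where "C4 = F + C3 * b"
  have "C4 \<ge> 0" using F0 \<open>C3 \<ge> 0\<close> b1 by (simp add: C4_def)
  have y''4: "\<bar>y'' x\<bar> \<le> C4 * s x" for x
  proof -
    have "(s x)\<^sup>2 * \<bar>y (x - \<phi> x)\<bar> \<le> (s x)\<^sup>2 * (C3 * b / s x)"
      using \<phi>0[of x] \<phi>1[of x] by (intro mult_left_mono y3') auto
    also have "\<dots> = C3 * b * s x"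
      using s0[of x] by (simp add: power2_eq_square)
    finally have "\<bar>y'' x\<bar> \<le> F + C3 * b * s x"
      using eq[of x] fF[of x] abs_mult[of "(s x)\<^sup>2" "y (x - \<phi> x)"] by simp
    moreover have "F * 1 \<le> F * s x" by (intro mult_left_mono s1 F0)
    ultimately show ?thesis by (simp add: C4_def algebra_simps)
  qed
  have "\<bar>y' x\<bar> \<le> 2 * C3 * b + C4 * b" for x
  proof -
    have "\<bar>y' x\<bar> \<le> 2 * (C3 * b / s x) / (1 / s x) + 1 / s x * (C4 * (b * s x))"
    proof (rule derivative_interpolation[OF y y'])
      fix t assume t: "t \<in> {x..x + 1 / s x}"
      show "\<bar>y t\<bar> \<le> C3 * b / s x" by (rule y3'[OF near[OF t]])
      have "C4 * s t \<le> C4 * (b * s x)"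
        by (intro mult_left_mono s_slow near t \<open>C4 \<ge> 0\<close>)
      then show "\<bar>y'' t\<bar> \<le> C4 * (b * s x)" using y''4[of t] by linarith
    qed (use s0 in auto)
    also have "\<dots> = 2 * C3 * b + C4 * b"
      using s0[of x] by (simp add: field_simps)
    finally show ?thesis .
  qed
  then show ?thesis by blast
qed

section \<open>The a priori estimate\<close>

text \<open>Absorption is carried out with the least bound \<open>P\<close> of \<open>\<bar>y'\<bar>\<close>: the bound
  \<open>\<bar>y'\<bar> \<le> 2 (F + P/6)\<close> then forces \<open>P \<le> 2 F + P/3\<close>.\<close>

lemma delay_solution_weighted_bound:
  fixes y y' y'' q f \<phi> :: "real \<Rightarrow> real"
  assumes y: "\<And>x. (y has_real_derivative y' x) (at x)"
    and y': "\<And>x. (y' has_real_derivative y'' x) (at x)"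
    and eq: "\<And>x. - y'' x + q x * y (x - \<phi> x) = f x"
    and yB: "\<And>x. \<bar>y x\<bar> \<le> B"
    and fF: "\<And>x. \<bar>f x\<bar> \<le> F"
    and q1: "\<And>x. q x \<ge> 1"
    and q_slow: "\<And>x t. \<bar>t - x\<bar> \<le> 1 \<Longrightarrow> q t \<le> a * q x"
    and \<phi>0: "\<And>x. \<phi> x \<ge> 0"
    and \<phi>q: "\<And>x. \<phi> x * q x \<le> 1 / 6"
  shows "\<bar>q x * y x\<bar> \<le> 5 * a * F"
proof -
  have a1: "a \<ge> 1" using q_slow[of 0 0] q1[of 0] by simp
  have F0: "F \<ge> 0" using fF[of 0] by linarith
  have q0: "q x \<ge> 0" for x using q1[of x] by linarith
  have "\<exists>P. \<forall>x. \<bar>y' x\<bar> \<le> P"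
  proof (rule delay_solution_derivative_bounded[where s = "\<lambda>x. sqrt (q x)" and b = "sqrt a", OF y y' _ yB fF])
    show "- y'' x + (sqrt (q x))\<^sup>2 * y (x - \<phi> x) = f x" for x
      using eq[of x] q0[of x] by simp
    show "sqrt (q t) \<le> sqrt a * sqrt (q x)" if "\<bar>t - x\<bar> \<le> 1" for t x
      using q_slow[OF that] by (simp flip: real_sqrt_mult)
    show "\<phi> x * (sqrt (q x))\<^sup>2 \<le> 1" for x
      using \<phi>q[of x] q0[of x] by simp
  qed (use q1 \<phi>0 in auto)
  then have bdd: "bdd_above (range (\<lambda>x. \<bar>y' x\<bar>))"
    by (auto simp: bdd_above_def)
  define P where "P = (SUP x. \<bar>y' x\<bar>)"
  have yP: "\<bar>y' x\<bar> \<le> P" for x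
    unfolding P_def using bdd by (intro cSUP_upper) auto
  define G where "G = F + P / 6"
  define g where "g x = f x + q x * (y x - y (x - \<phi> x))" for x
  have eq': "- y'' x + q x * y x = g x" for x
    using eq[of x] by (simp add: g_def algebra_simps)
  have "P \<ge> 0" using yP[of 0] by linarith
  have gG: "\<bar>g x\<bar> \<le> G" for x
  proof -
    have "\<bar>q x * (y x - y (x - \<phi> x))\<bar> \<le> \<phi> x * q x * P"
      by (intro delay_term_bound[OF y] \<phi>0 q0 yP)
    also have "\<dots> \<le> 1 / 6 * P" by (intro mult_right_mono \<phi>q \<open>P \<ge> 0\<close>)
    finally show ?thesis using fF[of x] by (simp add: g_def G_def)
  qed
  have yG: "\<bar>y x\<bar> \<le> G" for x
    by (rule bounded_solution_bound[OF y y' eq' yB q1 gG])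
  have "P \<le> 2 * G"
    unfolding P_def
    by (intro cSUP_least bounded_solution_slope_bound[OF y y' eq' q0 gG yG]) auto
  then have GF: "G \<le> 3 / 2 * F" by (simp add: G_def)
  have "G \<ge> 0" using gG[of 0] by linarith
  have "\<bar>y x\<bar> \<le> (G + 2 * G / 1\<^sup>2) / (q x / a)"
  proof (rule abs_bound_by_parabola[OF y y' eq'])
    fix t assume "\<bar>t - x\<bar> \<le> (1::real)"
    then have "q x \<le> a * q t" by (intro q_slow) (simp add: abs_minus_commute)
    then show "q x / a \<le> q t" using a1 by (simp add: field_simps)
  qed (use q1[of x] a1 yG gG \<open>G \<ge> 0\<close> in auto)
  then have "q x * \<bar>y x\<bar> \<le> 3 * a * G"
    using q1[of x] by (simp add: field_simps)
  also have "\<dots> \<le> 3 * a * (3 / 2 * F)"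
    using a1 by (intro mult_left_mono GF) auto
  also have "\<dots> \<le> 5 * a * F" using a1 F0 by simp
  finally show ?thesis using q0[of x] by (simp add: abs_mult)
qed

theorem corollary1p2:
  fixes \<phi> q :: "real \<Rightarrow> real" and a :: real
  assumes "continuous_on UNIV \<phi>" and "continuous_on UNIV q"
    and "\<And>x. \<phi> x \<ge> 0" and "\<And>x. q x \<ge> 1"
    and "a \<ge> 1"
    and "\<And>x t. t \<in> {x - 1..x + 1} \<Longrightarrow> inverse a * q x \<le> q t \<and> q t \<le> a * q x"
    and "bdd_above (range (\<lambda>x. \<phi> x * q x))"
    and "(SUP x. \<phi> x * q x) \<le> 1 / (6 * sqrt a)"
  shows "\<exists>c>0. \<forall>f y :: real \<Rightarrow>\<^sub>C real.
           delay_solution \<phi> q (apply_bcontfun f) (apply_bcontfun y) \<longrightarrow>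
           (\<lambda>x. q x * apply_bcontfun y x) \<in> bcontfun \<and>
           norm (Bcontfun (\<lambda>x. q x * apply_bcontfun y x)) \<le> c * norm f"
proof (intro exI[of _ "5 * a"] conjI allI impI)
  show "5 * a > 0" using \<open>a \<ge> 1\<close> by simp
  fix f y :: "real \<Rightarrow>\<^sub>C real"
  assume "delay_solution \<phi> q (apply_bcontfun f) (apply_bcontfun y)"
  then obtain y' y'' where
    y: "\<And>x. (apply_bcontfun y has_real_derivative y' x) (at x)" and
    y': "\<And>x. (y' has_real_derivative y'' x) (at x)" and
    eq: "\<And>x. - y'' x + q x * apply_bcontfun y (x - \<phi> x) = apply_bcontfun f x"
    unfolding delay_solution_def by blast
  have \<phi>q: "\<phi> x * q x \<le> 1 / 6" for x
  proof -
    have "\<phi> x * q x \<le> (SUP x. \<phi> x * q x)"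
      using assms(7) by (intro cSUP_upper) auto
    also have "\<dots> \<le> 1 / (6 * sqrt a)" by (rule assms(8))
    also have "\<dots> \<le> 1 / 6" using \<open>a \<ge> 1\<close> by (simp add: field_simps)
    finally show ?thesis .
  qed
  have bound: "\<bar>q x * apply_bcontfun y x\<bar> \<le> 5 * a * norm f" for x
  proof (rule delay_solution_weighted_bound[OF y y' eq, where B = "norm y"])
    show "\<bar>apply_bcontfun y t\<bar> \<le> norm y" "\<bar>apply_bcontfun f t\<bar> \<le> norm f" for t
      using norm_bounded[of y t] norm_bounded[of f t] by simp_all
    show "q t \<le> a * q x" if "\<bar>t - x\<bar> \<le> 1" for t x
      using assms(6)[of t x] that by (auto simp: abs_le_iff)
  qed (use assms \<phi>q in auto)
  show qy: "(\<lambda>x. q x * apply_bcontfun y x) \<in> bcontfun"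
    using assms(2) bound by (intro bcontfun_normI continuous_intros) auto
  show "norm (Bcontfun (\<lambda>x. q x * apply_bcontfun y x)) \<le> 5 * a * norm f"
    using bound by (intro norm_bound) (simp add: Bcontfun_inverse[OF qy])
qed

end
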